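(* Let $n\ge 4$, and let $P_1,\dots,P_n$ and $Q_1,\dots,Q_n$ be two $n$-tuples of projections with $P_i,Q_i:\mathbb{P}^k\dashrightarrow\mathbb{P}^{h_i}$, $i=1,\dots,n$. Assume that the associated critical locus $\mathcal{X}\subseteq\mathbb{P}^k$ has the expected dimension $2k-\sum_{i=1}^n h_i$ and that its codimension $c=\sum_{i=1}^n h_i-k$ satisfies $c\ge 2$. Then $\mathcal{X}$ is either not irreducible or singular.
   Context: We work over $\mathbb{C}$. A projection $P:\mathbb{P}^k\dashrightarrow\mathbb{P}^h$ ($1\le h<k$) is given by an $(h+1)\times(k+1)$ complex matrix of rank $h+1$ (up to a nonzero scalar), also denoted $P$; its center is the linear subspace of $\mathbb{P}^k$, of dimension $k-h-1$, given by the kernel of the matrix. With $\mathbf{X}=(x_0,\dots,x_k)^T$, $Q_i(\mathbf{X})=Q_i\cdot\mathbf{X}$ is a column of $h_i+1$ linear forms. The critical locus $\mathcal{X}$ of the two $n$-tuples is the subscheme of $\mathbb{P}^k$ defined by the ideal generated by the maximal minors (of order $n+k+1$) of the $(n+\sum_{i=1}^n h_i)\times(n+k+1)$ matrix $$M=\begin{pmatrix} P_1 & Q_1(\mathbf{X}) & 0 & \dots & 0\\ P_2 & 0 & Q_2(\mathbf{X}) & \dots & 0\\ \vdots & & & \ddots & \vdots\\ P_n & 0 & 0 & \dots & Q_n(\mathbf{X})\end{pmatrix}.$$ Standing assumptions: the centers of $P_1,\dots,P_n$ have empty common intersection and the centers of $Q_1,\dots,Q_n$ have empty common intersection. "Singular"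 means not smooth as a scheme over $\mathbb{C}$. *)

theory Defs
  imports
    "HOL-Library.Poly_Mapping"
    "HOL-Library.Extended_Real"
    "Jordan_Normal_Form.DL_Rank"
    "Jordan_Normal_Form.DL_Submatrix"
    "Jordan_Normal_Form.Matrix_Kernel"
begin

section \<open>Polynomials over the complex numbers\<close>

text \<open>
  A polynomial in the variables $x_0, x_1, \dots$ is a finitely supported map from monomials
  (finitely supported exponent functions) to coefficients; \<open>poly_ring k\<close> is
  $\mathbb{C}[x_0,\dots,x_k]$.
\<close>

type_synonym cpoly = "(nat \<Rightarrow>\<^sub>0 nat) \<Rightarrow>\<^sub>0 complex"

definition poly_ring :: "nat \<Rightarrow> cpoly set" where
  "poly_ring k = {f. \<forall>m \<in> Poly_Mapping.keys f. Poly_Mapping.keys m \<subseteq> {0..k}}"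

definition poly_const :: "complex \<Rightarrow> cpoly" where
  "poly_const c = Poly_Mapping.single 0 c"

definition poly_var :: "nat \<Rightarrow> cpoly" where
  "poly_var j = Poly_Mapping.single (Poly_Mapping.single j 1) 1"

definition poly_eval :: "cpoly \<Rightarrow> complex vec \<Rightarrow> complex" where
  "poly_eval f v = (\<Sum>m \<in> Poly_Mapping.keys f.
     Poly_Mapping.lookup f m * (\<Prod>j \<in> Poly_Mapping.keys m. (v $ j) ^ Poly_Mapping.lookup m j))"

text \<open>
  The formal partial derivative. Where \<open>lookup m j = 0\<close> the subtraction truncates, but the
  coefficient is then zero.
\<close>

definition poly_partial :: "nat \<Rightarrow> cpoly \<Rightarrow> cpoly" where
  "poly_partial j f = (\<Sum>m \<in> Poly_Mapping.keys f.
     Poly_Mapping.single (m - Poly_Mapping.single j 1)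
       (of_nat (Poly_Mapping.lookup m j) * Poly_Mapping.lookup f m))"

definition poly_homogeneous :: "cpoly \<Rightarrow> bool" where
  "poly_homogeneous f \<longleftrightarrow>
     (\<exists>d. \<forall>m \<in> Poly_Mapping.keys f. (\<Sum>j \<in> Poly_Mapping.keys m. Poly_Mapping.lookup m j) = d)"

definition poly_ideal :: "nat \<Rightarrow> cpoly set \<Rightarrow> cpoly set" where
  "poly_ideal k S = {\<Sum>s \<in> T. a s * s | T a. finite T \<and> T \<subseteq> S \<and> (\<forall>s \<in> T. a s \<in> poly_ring k)}"

section \<open>Projective space and its Zariski topology\<close>

text \<open>
  A (closed) point of $\mathbb{P}^k$ is the set of its homogeneous coordinate vectors.
\<close>

type_synonym proj_point = "complex vec set"

definition proj_pt :: "complex vec \<Rightarrow> proj_point" where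
  "proj_pt v = {c \<cdot>\<^sub>v v | c. c \<noteq> 0}"

definition proj_space :: "nat \<Rightarrow> proj_point set" where
  "proj_space k = {proj_pt v | v. v \<in> carrier_vec (k + 1) \<and> v \<noteq> 0\<^sub>v (k + 1)}"

definition zero_locus :: "nat \<Rightarrow> cpoly set \<Rightarrow> proj_point set" where
  "zero_locus k S = {p \<in> proj_space k. \<forall>f \<in> S. \<forall>v \<in> p. poly_eval f v = 0}"

definition zariski_closed :: "nat \<Rightarrow> proj_point set \<Rightarrow> bool" where
  "zariski_closed k Z \<longleftrightarrow>
     (\<exists>S. S \<subseteq> poly_ring k \<and> (\<forall>f \<in> S. poly_homogeneous f) \<and> Z = zero_locus k S)"

definition zariski_irreducible :: "nat \<Rightarrow> proj_point set \<Rightarrow> bool" where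
  "zariski_irreducible k Z \<longleftrightarrow> Z \<noteq> {} \<and>
     (\<forall>A B. zariski_closed k A \<and> zariski_closed k B \<and> Z \<subseteq> A \<union> B \<longrightarrow> Z \<subseteq> A \<or> Z \<subseteq> B)"

text \<open>
  \<open>irreducible_chain k Z C d\<close>: $C_0 \subsetneq \dots \subsetneq C_d$ are irreducible closed subsets
  of the closed set \<open>Z\<close>.
\<close>

definition irreducible_chain ::
    "nat \<Rightarrow> proj_point set \<Rightarrow> (nat \<Rightarrow> proj_point set) \<Rightarrow> nat \<Rightarrow> bool" where
  "irreducible_chain k Z C d \<longleftrightarrow>
     (\<forall>i \<le> d. zariski_closed k (C i) \<and> zariski_irreducible k (C i) \<and> C i \<subseteq> Z) \<and>
     (\<forall>i < d. C i \<subset> C (Suc i))"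

text \<open>
  Krull dimension; it is \<open>-\<infinity>\<close> for the empty set.
\<close>

definition krull_dim :: "nat \<Rightarrow> proj_point set \<Rightarrow> ereal" where
  "krull_dim k Z = Sup {ereal (real d) | d. \<exists>C. irreducible_chain k Z C d}"

text \<open>
  The irreducible closed subsets of \<open>Z\<close> through a closed point \<open>p\<close> correspond to the prime ideals
  of the local ring $\mathcal{O}_{Z,p}$, so this is its Krull dimension.
\<close>

definition local_dim :: "nat \<Rightarrow> proj_point set \<Rightarrow> proj_point \<Rightarrow> ereal" where
  "local_dim k Z p = Sup {ereal (real d) | d. \<exists>C. irreducible_chain k Z C d \<and> p \<in> C 0}"

section \<open>Smoothness of a closed subscheme of projective space\<close>

text \<open>
  A closed subscheme of $\mathbb{P}^k$ is represented by a homogeneous ideal \<open>I\<close> of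
  \<open>poly_ring k\<close>; its underlying set of closed points is \<open>zero_locus k I\<close>.

  For a coordinate vector \<open>v\<close> of a point \<open>p\<close> of the subscheme, \<open>cone_tangent_space k I v\<close> is the
  set of all \<open>w\<close> such that $v + \epsilon w$ satisfies every equation in \<open>I\<close> modulo $\epsilon^2$.
  The Zariski tangent space of the subscheme at \<open>p\<close>, dual to the fibre at \<open>p\<close> of the sheaf
  of differentials, is its quotient by the line spanned by \<open>v\<close>.
\<close>

definition cone_tangent_space :: "nat \<Rightarrow> cpoly set \<Rightarrow> complex vec \<Rightarrow> complex vec set" where
  "cone_tangent_space k I v = {w \<in> carrier_vec (k + 1).
     \<forall>f \<in> I. (\<Sum>j = 0..k. poly_eval (poly_partial j f) v * w $ j) = 0}"

definition subspace_dim :: "nat \<Rightarrow> complex vec set \<Rightarrow> nat" where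
  "subspace_dim N W =
     vectorspace.dim class_ring (module_vec TYPE(complex) N \<lparr>carrier := W\<rparr>)"

text \<open>
  Smoothness over $\mathbb{C}$: at every closed point, the fibre of the sheaf of differentials
  (equivalently the tangent space) has dimension equal to the local dimension.
\<close>

definition smooth_subscheme :: "nat \<Rightarrow> cpoly set \<Rightarrow> bool" where
  "smooth_subscheme k I \<longleftrightarrow> (\<forall>p \<in> zero_locus k I. \<forall>v \<in> p.
     ereal (real (subspace_dim (k + 1) (cone_tangent_space k I v)))
       = local_dim k (zero_locus k I) p + 1)"

section \<open>Projections and critical loci\<close>

definition is_projection :: "nat \<Rightarrow> nat \<Rightarrow> complex mat \<Rightarrow> bool" where
  "is_projection k h A \<longleftrightarrow> 1 \<le> h \<and> h < k \<and>
     A \<in> carrier_mat (h + 1) (k + 1) \<and> vec_space.rank (h + 1) A = h + 1"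

definition center :: "nat \<Rightarrow> complex mat \<Rightarrow> proj_point set" where
  "center k A = {p \<in> proj_space k. p \<subseteq> mat_kernel A}"

text \<open>
  The views are numbered \<open>0, \<dots>, n - 1\<close>. Row \<open>a\<close> of the \<open>i\<close>-th block of the matrix $M$ has row
  \<open>a\<close> of $P_i$ in its first \<open>k + 1\<close> entries, and the linear form $Q_i(\mathbf{X})_a$ in the column
  with index \<open>k + 1 + i\<close>.
\<close>

definition critical_row ::
    "nat \<Rightarrow> nat \<Rightarrow> (nat \<Rightarrow> complex mat) \<Rightarrow> (nat \<Rightarrow> complex mat) \<Rightarrow> nat \<Rightarrow> nat \<Rightarrow> cpoly vec" where
  "critical_row n k P Q i a = vec (n + k + 1) (\<lambda>j.
     if j \<le> k then poly_const (P i $$ (a, j))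
     else if j = k + 1 + i then (\<Sum>l = 0..k. poly_const (Q i $$ (a, l)) * poly_var l)
     else 0)"

definition critical_matrix ::
    "nat \<Rightarrow> nat \<Rightarrow> (nat \<Rightarrow> nat) \<Rightarrow> (nat \<Rightarrow> complex mat) \<Rightarrow> (nat \<Rightarrow> complex mat) \<Rightarrow> cpoly mat" where
  "critical_matrix n k h P Q = mat_of_rows (n + k + 1)
     (concat (map (\<lambda>i. map (critical_row n k P Q i) [0..<h i + 1]) [0..<n]))"

definition critical_ideal ::
    "nat \<Rightarrow> nat \<Rightarrow> (nat \<Rightarrow> nat) \<Rightarrow> (nat \<Rightarrow> complex mat) \<Rightarrow> (nat \<Rightarrow> complex mat) \<Rightarrow> cpoly set" where
  "critical_ideal n k h P Q = poly_ideal k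
     {det (submatrix (critical_matrix n k h P Q) R UNIV) | R.
        R \<subseteq> {..<dim_row (critical_matrix n k h P Q)} \<and> card R = n + k + 1}"

abbreviation critical_locus ::
    "nat \<Rightarrow> nat \<Rightarrow> (nat \<Rightarrow> nat) \<Rightarrow> (nat \<Rightarrow> complex mat) \<Rightarrow> (nat \<Rightarrow> complex mat) \<Rightarrow> proj_point set" where
  "critical_locus n k h P Q \<equiv> zero_locus k (critical_ideal n k h P Q)"

end

theory Submission
  imports Defs
begin

text \<open>
  Suppose \<open>X\<close> is irreducible and smooth. The center $L_i$ of $Q_i$ is a nonempty linear subspace
  of dimension $k - h_i - 1$, contained in \<open>X\<close> because the column of $Q_i(\mathbf{X})$ vanishes
  on it.
  At a point of $L_i \cap L_j$ with $i \neq j$ two columns of $M$ vanish, so all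
  maximal minors vanish to order two and the tangent space is everything, although
  $\dim X \le k - 2$. Hence the centers are pairwise disjoint, which forces $h_i + h_j \ge k - 1$.
  It also forces $L_i \subsetneq X$, so $k - h_i \le \dim X = k - c$, that is $h_i \ge c \ge 2$ and
  the sum of the $h_j$ with $j \neq i$ is at most $k$. With four views, take three different from
  \<open>i\<close>: two of them contribute at least $k - 1$ and the third at least $2$, a contradiction.
\<close>

section \<open>Evaluation and partial derivatives\<close>

definition monom_eval :: "(nat \<Rightarrow>\<^sub>0 nat) \<Rightarrow> complex vec \<Rightarrow> complex" where
  "monom_eval m v = (\<Prod>j \<in> Poly_Mapping.keys m. (v $ j) ^ Poly_Mapping.lookup m j)"

lemma monom_eval_superset:
  assumes "finite A" "Poly_Mapping.keys m \<subseteq> A"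
  shows "monom_eval m v = (\<Prod>j \<in> A. (v $ j) ^ Poly_Mapping.lookup m j)"
  unfolding monom_eval_def using assms
  by (intro prod.mono_neutral_left) (auto simp: in_keys_iff)

lemma monom_eval_add: "monom_eval (m + m') v = monom_eval m v * monom_eval m' v"
proof -
  let ?A = "Poly_Mapping.keys m \<union> Poly_Mapping.keys m'"
  have "Poly_Mapping.keys (m + m') \<subseteq> ?A" by (rule keys_add)
  then show ?thesis
    by (simp add: monom_eval_superset[of ?A] lookup_add power_add prod.distrib)
qed

lemma poly_eval_add: "poly_eval (f + g) v = poly_eval f v + poly_eval g v"
  unfolding poly_eval_def
  by (rule setsum_keys_plus_distrib) (auto simp: algebra_simps)

lemma poly_eval_0 [simp]: "poly_eval 0 v = 0"
  by (simp add: poly_eval_def)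

lemma poly_eval_sum: "poly_eval (\<Sum>x\<in>A. f x) v = (\<Sum>x\<in>A. poly_eval (f x) v)"
  by (induction A rule: infinite_finite_induct) (auto simp: poly_eval_add)

lemma poly_eval_single: "poly_eval (Poly_Mapping.single m a) v = a * monom_eval m v"
  by (cases "a = 0") (auto simp: poly_eval_def monom_eval_def)

lemma poly_partial_add: "poly_partial j (f + g) = poly_partial j f + poly_partial j g"
  unfolding poly_partial_def
  by (rule setsum_keys_plus_distrib) (auto simp: algebra_simps single_add)

lemma poly_partial_0 [simp]: "poly_partial j 0 = 0"
  by (simp add: poly_partial_def)

lemma poly_partial_sum: "poly_partial j (\<Sum>x\<in>A. f x) = (\<Sum>x\<in>A. poly_partial j (f x))"
  by (induction A rule: infinite_finite_induct) (auto simp: poly_partial_add)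

lemma poly_partial_single:
  "poly_partial j (Poly_Mapping.single m a)
     = Poly_Mapping.single (m - Poly_Mapping.single j 1) (of_nat (Poly_Mapping.lookup m j) * a)"
  by (cases "a = 0") (auto simp: poly_partial_def)

text \<open>Reduces additive and bilinear identities between polynomials to single
  monomials.\<close>

lemma cpoly_expand:
  fixes f :: cpoly
  shows "f = (\<Sum>m\<in>Poly_Mapping.keys f. Poly_Mapping.single m (Poly_Mapping.lookup f m))"
  by (rule poly_mapping_eqI)
     (auto simp: lookup_sum lookup_single when_def in_keys_iff)

lemma poly_eval_mult: "poly_eval (f * g) v = poly_eval f v * poly_eval g v"
  \<comment> \<open>An expansion leaves two copies of the polynomial inside the sum, so its next
    unexpanded occurrence is the third.\<close>
  by (subst cpoly_expand[of f], subst cpoly_expand[of g],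
      subst (3) cpoly_expand[of f], subst (3) cpoly_expand[of g])
     (simp add: sum_product poly_eval_sum mult_single poly_eval_single monom_eval_add mult_ac)

text \<open>The common factor absorbs truncated subtraction: if it is zero, both sides vanish;
  otherwise one power of the variable can be taken out of \<open>m\<close> itself.\<close>

lemma monom_eval_partial:
  "of_nat (Poly_Mapping.lookup m j) * monom_eval (m + m' - Poly_Mapping.single j 1) v
     = of_nat (Poly_Mapping.lookup m j) * (monom_eval (m - Poly_Mapping.single j 1) v * monom_eval m' v)"
proof (cases "Poly_Mapping.lookup m j = 0")
  case False
  then have "m + m' - Poly_Mapping.single j 1 = (m - Poly_Mapping.single j 1) + m'"
    by (intro poly_mapping_eqI) (auto simp: lookup_add lookup_minus lookup_single when_def)
  then show ?thesis by (simp add: monom_eval_add)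
qed simp

text \<open>The Leibniz rule. Both sides are bilinear in \<open>f\<close> and \<open>g\<close>, so
  monomials suffice.\<close>

lemma poly_eval_partial_mult:
  "poly_eval (poly_partial j (f * g)) v
     = poly_eval (poly_partial j f) v * poly_eval g v + poly_eval f v * poly_eval (poly_partial j g) v"
proof -
  have single: "poly_eval (poly_partial j (Poly_Mapping.single m a * Poly_Mapping.single m' b)) v
      = poly_eval (poly_partial j (Poly_Mapping.single m a)) v * poly_eval (Poly_Mapping.single m' b) v
      + poly_eval (Poly_Mapping.single m a) v * poly_eval (poly_partial j (Poly_Mapping.single m' b)) v"
    for m m' a b
    using monom_eval_partial[of m j m' v] monom_eval_partial[of m' j m v]
    by (simp add: mult_single poly_partial_single poly_eval_single lookup_add add.commute[of m' m])
       (auto simp: algebra_simps)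
  show ?thesis
    by (subst cpoly_expand[of f], subst cpoly_expand[of g],
        subst (3) cpoly_expand[of f], subst (3) cpoly_expand[of g],
        subst (5) cpoly_expand[of f], subst (5) cpoly_expand[of g])
       (simp add: sum_product poly_eval_sum poly_partial_sum single sum.distrib)
qed

section \<open>Vanishing to first and second order at a vector\<close>

definition vanish1 :: "complex vec \<Rightarrow> cpoly set" where
  "vanish1 v = {f. poly_eval f v = 0}"

definition vanish2 :: "complex vec \<Rightarrow> cpoly set" where
  "vanish2 v = {f. poly_eval f v = 0 \<and> (\<forall>j. poly_eval (poly_partial j f) v = 0)}"

lemma vanish1_sum: "(\<And>x. x \<in> A \<Longrightarrow> f x \<in> vanish1 v) \<Longrightarrow> (\<Sum>x\<in>A. f x) \<in> vanish1 v"
  by (auto simp: vanish1_def poly_eval_sum)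

lemma vanish1_mult: "f \<in> vanish1 v \<Longrightarrow> a * f \<in> vanish1 v"
  by (auto simp: vanish1_def poly_eval_mult)

lemma vanish2_sum: "(\<And>x. x \<in> A \<Longrightarrow> f x \<in> vanish2 v) \<Longrightarrow> (\<Sum>x\<in>A. f x) \<in> vanish2 v"
  by (auto simp: vanish2_def poly_eval_sum poly_partial_sum)

lemma vanish2_mult: "f \<in> vanish2 v \<Longrightarrow> a * f \<in> vanish2 v"
  by (auto simp: vanish2_def poly_eval_mult poly_eval_partial_mult)

lemma vanish1_times_vanish1: "f \<in> vanish1 v \<Longrightarrow> g \<in> vanish1 v \<Longrightarrow> f * g \<in> vanish2 v"
  by (auto simp: vanish1_def vanish2_def poly_eval_mult poly_eval_partial_mult)

text \<open>Every term of the Leibniz expansion contains an entry of column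
  \<open>c\<close>.\<close>

lemma det_in_vanish1:
  assumes A: "A \<in> carrier_mat N N" and c: "c < N"
    and van: "\<And>i. i < N \<Longrightarrow> A $$ (i, c) \<in> vanish1 v"
  shows "det A \<in> vanish1 v"
  unfolding det_def'[OF A]
proof (intro vanish1_sum vanish1_mult)
  fix p assume "p \<in> {p. p permutes {0..<N}}"
  then have p: "p permutes {0..<N}" by simp
  define i where "i = inv_into UNIV p c"
  have i: "i < N" "p i = c"
    using permutes_in_image[OF permutes_inv[OF p], of c] permutes_inverses(1)[OF p] c
    by (auto simp: i_def)
  have "(\<Prod>i = 0..<N. A $$ (i, p i)) = (\<Prod>i \<in> {0..<N} - {i}. A $$ (i, p i)) * A $$ (i, c)"
    using i by (subst prod.remove[of _ i]) (auto simp: mult.commute)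
  then show "(\<Prod>i = 0..<N. A $$ (i, p i)) \<in> vanish1 v"
    using van[OF i(1)] by (simp add: vanish1_mult)
qed

text \<open>Every term of the Leibniz expansion contains one entry from each of the two columns, and
  a product of two vanishing factors vanishes to second order.\<close>

lemma det_in_vanish2:
  assumes A: "A \<in> carrier_mat N N" and c: "c < N" "c' < N" "c \<noteq> c'"
    and van: "\<And>i. i < N \<Longrightarrow> A $$ (i, c) \<in> vanish1 v" "\<And>i. i < N \<Longrightarrow> A $$ (i, c') \<in> vanish1 v"
  shows "det A \<in> vanish2 v"
  unfolding det_def'[OF A]
proof (intro vanish2_sum vanish2_mult)
  fix p assume "p \<in> {p. p permutes {0..<N}}"
  then have p: "p permutes {0..<N}" by simp
  define i i' where "i = inv_into UNIV p c" and "i' = inv_into UNIV p c'"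
  have i: "i < N" "p i = c" "i' < N" "p i' = c'"
    using permutes_in_image[OF permutes_inv[OF p], of c] permutes_inverses(1)[OF p] c
      permutes_in_image[OF permutes_inv[OF p], of c']
    by (auto simp: i_def i'_def)
  \<comment> \<open>The rows \<open>i\<close> and \<open>i'\<close> are distinct because
    \<open>p\<close> sends them to different columns, so both factors can be split off.\<close>
  have "(\<Prod>i = 0..<N. A $$ (i, p i))
      = (\<Prod>i \<in> {0..<N} - {i} - {i'}. A $$ (i, p i)) * (A $$ (i, c) * A $$ (i', c'))"
    using i c by (subst prod.remove[of _ i], simp, simp, subst prod.remove[of _ i'])
      (auto simp: mult_ac)
  then show "(\<Prod>i = 0..<N. A $$ (i, p i)) \<in> vanish2 v"
    using van(1)[OF i(1)] van(2)[OF i(3)] by (simp add: vanish2_mult vanish1_times_vanish1)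
qed

section \<open>Homogeneous polynomials\<close>

text \<open>Records the degree, which \<open>poly_homogeneous\<close> hides, and sums exponents over
  a fixed range, so that degrees add under multiplication. Zero has every degree.\<close>

definition homog_poly :: "nat \<Rightarrow> nat \<Rightarrow> cpoly \<Rightarrow> bool" where
  "homog_poly k d f \<longleftrightarrow> (\<forall>m \<in> Poly_Mapping.keys f.
     Poly_Mapping.keys m \<subseteq> {0..k} \<and> (\<Sum>j = 0..k. Poly_Mapping.lookup m j) = d)"

lemma homog_poly_0: "homog_poly k d 0"
  by (simp add: homog_poly_def)

lemma homog_poly_const: "homog_poly k 0 (poly_const c)"
  by (auto simp: homog_poly_def poly_const_def)

lemma homog_poly_var: "j \<le> k \<Longrightarrow> homog_poly k 1 (poly_var j)"
  by (auto simp: homog_poly_def poly_var_def lookup_single when_def)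

lemma homog_poly_add: "homog_poly k d f \<Longrightarrow> homog_poly k d g \<Longrightarrow> homog_poly k d (f + g)"
  using keys_add[of f g] unfolding homog_poly_def by blast

lemma homog_poly_sum: "(\<And>x. x \<in> A \<Longrightarrow> homog_poly k d (f x)) \<Longrightarrow> homog_poly k d (\<Sum>x\<in>A. f x)"
  by (induction A rule: infinite_finite_induct) (auto simp: homog_poly_0 homog_poly_add)

lemma homog_poly_uminus: "homog_poly k d f \<Longrightarrow> homog_poly k d (- f)"
  by (simp add: homog_poly_def)

lemma homog_poly_mult:
  assumes "homog_poly k d f" "homog_poly k e g"
  shows "homog_poly k (d + e) (f * g)"
  unfolding homog_poly_def
proof
  fix m assume "m \<in> Poly_Mapping.keys (f * g)"
  then obtain a b where m: "m = a + b" and a: "a \<in> Poly_Mapping.keys f" and b: "b \<in> Poly_Mapping.keys g"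
    using keys_mult by blast
  then show "Poly_Mapping.keys m \<subseteq> {0..k} \<and> (\<Sum>j = 0..k. Poly_Mapping.lookup m j) = d + e"
    using assms keys_add[of a b] unfolding homog_poly_def
    by (simp add: lookup_add sum.distrib) blast
qed

lemma homog_poly_prod:
  "(\<And>x. x \<in> A \<Longrightarrow> homog_poly k (d x) (f x)) \<Longrightarrow> homog_poly k (\<Sum>x\<in>A. d x) (\<Prod>x\<in>A. f x)"
  by (induction A rule: infinite_finite_induct)
     (auto intro: homog_poly_mult homog_poly_const[of k 1, unfolded poly_const_def, simplified])

lemma homog_poly_imp_poly_ring: "homog_poly k d f \<Longrightarrow> f \<in> poly_ring k"
  by (auto simp: homog_poly_def poly_ring_def)

lemma homog_poly_imp_homogeneous:
  assumes "homog_poly k d f"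
  shows "poly_homogeneous f"
proof -
  have "(\<Sum>j\<in>Poly_Mapping.keys m. Poly_Mapping.lookup m j) = d" if "m \<in> Poly_Mapping.keys f" for m
  proof -
    have "(\<Sum>j\<in>Poly_Mapping.keys m. Poly_Mapping.lookup m j) = (\<Sum>j = 0..k. Poly_Mapping.lookup m j)"
      using assms that unfolding homog_poly_def
      by (intro sum.mono_neutral_left) (auto simp: in_keys_iff)
    then show ?thesis using assms that by (simp add: homog_poly_def)
  qed
  then show ?thesis unfolding poly_homogeneous_def by blast
qed

text \<open>The degree depends only on the column, and each Leibniz term meets every column
  once.\<close>

lemma homog_poly_det:
  assumes A: "A \<in> carrier_mat N N"
    and hom: "\<And>i c. i < N \<Longrightarrow> c < N \<Longrightarrow> homog_poly k (d c) (A $$ (i, c))"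
  shows "homog_poly k (\<Sum>c<N. d c) (det A)"
  unfolding det_def'[OF A]
proof (rule homog_poly_sum)
  fix p assume "p \<in> {p. p permutes {0..<N}}"
  then have p: "p permutes {0..<N}" by simp
  have "homog_poly k (\<Sum>i = 0..<N. d (p i)) (\<Prod>i = 0..<N. A $$ (i, p i))"
    using permutes_in_image[OF p] by (intro homog_poly_prod hom) auto
  moreover have "(\<Sum>i = 0..<N. d (p i)) = (\<Sum>c<N. d c)"
    using sum.permute[OF p, of d] by (simp add: comp_def lessThan_atLeast0)
  ultimately show "homog_poly k (\<Sum>c<N. d c) (signof p * (\<Prod>i = 0..<N. A $$ (i, p i)))"
    by (auto simp: sign_def homog_poly_uminus)
qed

section \<open>Linear loci\<close>

definition lin_form :: "nat \<Rightarrow> (nat \<Rightarrow> complex) \<Rightarrow> cpoly" where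
  "lin_form k a = (\<Sum>l = 0..k. poly_const (a l) * poly_var l)"

lemma homog_poly_lin_form: "homog_poly k 1 (lin_form k a)"
  unfolding lin_form_def
  using homog_poly_mult[OF homog_poly_const homog_poly_var] by (intro homog_poly_sum) auto

lemma poly_eval_lin_form: "poly_eval (lin_form k a) v = (\<Sum>l = 0..k. a l * v $ l)"
  by (simp add: lin_form_def poly_eval_sum poly_eval_mult poly_const_def poly_var_def
      poly_eval_single monom_eval_def)

text \<open>Fewer equations than unknowns: padding the coefficient rows with zero rows gives a
  singular square matrix.\<close>

lemma exists_common_zero:
  assumes "length as \<le> k"
  shows "\<exists>v \<in> carrier_vec (k + 1). v \<noteq> 0\<^sub>v (k + 1) \<and> (\<forall>a \<in> set as. poly_eval (lin_form k a) v = 0)"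
proof -
  \<comment> \<open>The outer conditional has the shape used by \<open>det_row_0\<close>. Row
    \<open>k\<close> lies beyond all the forms, so none is overwritten.\<close>
  define A where "A = mat\<^sub>r (k + 1) (k + 1)
    (\<lambda>i. if i = k then 0\<^sub>v (k + 1) else vec (k + 1) (if i < length as then as ! i else (\<lambda>_. 0)))"
  have A: "A \<in> carrier_mat (k + 1) (k + 1)" by (simp add: A_def)
  have "det A = 0" unfolding A_def by (rule det_row_0) auto
  then obtain v where v: "v \<in> carrier_vec (k + 1)" "v \<noteq> 0\<^sub>v (k + 1)" "A *\<^sub>v v = 0\<^sub>v (k + 1)"
    using det_0_iff_vec_prod_zero_field[OF A] by auto
  have "poly_eval (lin_form k (as ! i)) v = 0" if i: "i < length as" for i
  proof -
    have "0 = (A *\<^sub>v v) $ i" using v(3) i assms by simp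
    also have "\<dots> = row A i \<bullet> v" using A i assms by simp
    also have "row A i = vec (k + 1) (as ! i)" using i assms by (auto simp: A_def)
    finally show ?thesis
      using v(1) by (simp add: poly_eval_lin_form scalar_prod_def atLeastLessThanSuc_atLeastAtMost)
  qed
  then show ?thesis using v by (metis in_set_conv_nth)
qed

lemma mem_proj_pt_self: "v \<in> proj_pt v"
  unfolding proj_pt_def by (auto intro: exI[of _ 1])

text \<open>Linear forms scale with the vector, so a single representative decides
  membership.\<close>

lemma proj_pt_zero_locus_lin:
  assumes "v \<in> carrier_vec (k + 1)" "v \<noteq> 0\<^sub>v (k + 1)"
  shows "proj_pt v \<in> zero_locus k (lin_form k ` A) \<longleftrightarrow> (\<forall>a \<in> A. poly_eval (lin_form k a) v = 0)"
proof -
  have scale: "poly_eval (lin_form k a) (c \<cdot>\<^sub>v v) = c * poly_eval (lin_form k a) v" for a c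
    using assms(1) by (auto simp: poly_eval_lin_form sum_distrib_left intro!: sum.cong)
  have "proj_pt v \<in> proj_space k" using assms by (auto simp: proj_space_def)
  then show ?thesis
    unfolding zero_locus_def using mem_proj_pt_self[of v]
    by (auto simp: proj_pt_def scale)
qed

lemma proj_point_member:
  assumes "p \<in> proj_space k" "v \<in> p"
  shows "v \<in> carrier_vec (k + 1)" "v \<noteq> 0\<^sub>v (k + 1)"
proof -
  obtain u c where u: "u \<in> carrier_vec (k + 1)" "u \<noteq> 0\<^sub>v (k + 1)" "p = proj_pt u"
    and c: "v = c \<cdot>\<^sub>v u" "c \<noteq> 0"
    using assms unfolding proj_space_def proj_pt_def by blast
  show v: "v \<in> carrier_vec (k + 1)" using u c by simp
  have uv: "u = inverse c \<cdot>\<^sub>v v" using c by (simp add: smult_smult_assoc)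
  show "v \<noteq> 0\<^sub>v (k + 1)" using uv u(2) by auto
qed

section \<open>Irreducibility of linear subspaces\<close>

lemma poly_eval_line:
  "\<exists>q. \<forall>t. poly_eval f (vec N (\<lambda>j. v j + t * u j)) = poly q t"
proof -
  have coord: "\<exists>q. \<forall>t. vec N (\<lambda>j. v j + t * u j) $ i = poly q t" for i
  proof (cases "i < N")
    case True
    then show ?thesis by (intro exI[of _ "[:v i, u i:]"]) simp
  next
    case False
    \<comment> \<open>Variables of index at least \<open>N\<close> may occur in \<open>f\<close>.
      The default value there is the same for all entry functions, hence constant in
      \<open>t\<close>.\<close>
    then have "vec N g $ i = undef_vec (i - N)" for g :: "nat \<Rightarrow> complex"
      by transfer (simp add: mk_vec_def)
    then show ?thesis by (intro exI[of _ "[:undef_vec (i - N):]"]) simp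
  qed
  then obtain c where c: "\<And>i t. vec N (\<lambda>j. v j + t * u j) $ i = poly (c i) t" by metis
  show ?thesis
    by (intro exI[of _ "\<Sum>m \<in> Poly_Mapping.keys f.
       [:Poly_Mapping.lookup f m:] * (\<Prod>j \<in> Poly_Mapping.keys m. c j ^ Poly_Mapping.lookup m j)"])
      (simp add: poly_eval_def c poly_sum poly_prod)
qed

lemma zariski_closed_zero_locus_homog:
  "(\<And>f. f \<in> S \<Longrightarrow> homog_poly k d f) \<Longrightarrow> zariski_closed k (zero_locus k S)"
  unfolding zariski_closed_def
  by (intro exI[of _ S]) (auto dest: homog_poly_imp_poly_ring homog_poly_imp_homogeneous)

text \<open>A point outside \<open>A\<close> and a point outside \<open>B\<close> are joined by a
  line inside the locus. Equations that separate them restrict to nonzero polynomials in one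
  variable, so some point of the line avoids both closed sets.\<close>

lemma irreducible_linear_locus:
  assumes "length as \<le> k"
  shows "zariski_irreducible k (zero_locus k (lin_form k ` set as))" (is "zariski_irreducible k ?L")
  unfolding zariski_irreducible_def
proof (intro conjI allI impI)
  show "?L \<noteq> {}"
    using exists_common_zero[OF assms] proj_pt_zero_locus_lin by blast
next
  fix A B assume "zariski_closed k A \<and> zariski_closed k B \<and> ?L \<subseteq> A \<union> B"
  then obtain S T where S: "A = zero_locus k S" and T: "B = zero_locus k T" and AB: "?L \<subseteq> A \<union> B"
    unfolding zariski_closed_def by blast
  show "?L \<subseteq> A \<or> ?L \<subseteq> B"
  proof (rule ccontr)
    assume "\<not> (?L \<subseteq> A \<or> ?L \<subseteq> B)"
    then obtain p p' where p: "p \<in> ?L" "p \<notin> A" and p': "p' \<in> ?L" "p' \<notin> B" by blast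
    then have ps: "p \<in> proj_space k" "p' \<in> proj_space k" by (auto simp: zero_locus_def)
    obtain f v where f: "f \<in> S" "v \<in> p" "poly_eval f v \<noteq> 0"
      using p ps by (auto simp: S zero_locus_def)
    obtain g w where g: "g \<in> T" "w \<in> p'" "poly_eval g w \<noteq> 0"
      using p' ps by (auto simp: T zero_locus_def)
    note v = proj_point_member[OF ps(1) f(2)] and w = proj_point_member[OF ps(2) g(2)]
    have va: "poly_eval (lin_form k a) v = 0" and wa: "poly_eval (lin_form k a) w = 0"
      if "a \<in> set as" for a
      using that p(1) p'(1) f(2) g(2) by (auto simp: zero_locus_def)
    define x where "x t = vec (k + 1) (\<lambda>j. v $ j + t * (w $ j - v $ j))" for t
    obtain q where q: "\<And>t. poly_eval f (x t) = poly q t"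
      unfolding x_def using poly_eval_line[of f "k + 1" "($) v" "\<lambda>j. w $ j - v $ j"] by blast
    obtain r where r: "\<And>t. poly_eval g (x t) = poly r t"
      unfolding x_def using poly_eval_line[of g "k + 1" "($) v" "\<lambda>j. w $ j - v $ j"] by blast
    have x0: "x 0 = v" and x1: "x 1 = w" using v(1) w(1) by (auto simp: x_def)
    obtain j where j: "j < k + 1" "v $ j \<noteq> 0" using v(1,2) by (metis carrier_vecD eq_vecI index_zero_vec(1,2))
    \<comment> \<open>This is coordinate \<open>j\<close> of \<open>x t\<close>. Avoiding its root
      keeps \<open>x t\<close> nonzero, since the line of vectors may pass through the
      origin.\<close>
    define s where "s = [:v $ j, w $ j - v $ j:]"
    have "q \<noteq> 0" using q[of 0] f(3) x0 by auto
    moreover have "r \<noteq> 0" using r[of 1] g(3) x1 by auto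
    moreover have "s \<noteq> 0" using j by (simp add: s_def)
    ultimately have "finite {t. poly (q * r * s) t = 0}" by (intro poly_roots_finite) simp
    then obtain t where "poly (q * r * s) t \<noteq> 0"
      using ex_new_if_finite[OF infinite_UNIV_char_0] by blast
    then have "poly q t \<noteq> 0" "poly r t \<noteq> 0" "poly s t \<noteq> 0" by auto
    then have t: "poly_eval f (x t) \<noteq> 0" "poly_eval g (x t) \<noteq> 0" "x t $ j \<noteq> 0"
      using j unfolding q r by (auto simp: s_def x_def)
    have xc: "x t \<in> carrier_vec (k + 1)" "x t \<noteq> 0\<^sub>v (k + 1)"
      using t(3) j(1) by (simp add: x_def, metis index_zero_vec(1))
    have "poly_eval (lin_form k a) (x t)
        = (1 - t) * poly_eval (lin_form k a) v + t * poly_eval (lin_form k a) w" for a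
      by (auto simp: poly_eval_lin_form x_def sum_distrib_left algebra_simps simp flip: sum.distrib intro!: sum.cong)
    then have "proj_pt (x t) \<in> ?L"
      using va wa by (simp add: proj_pt_zero_locus_lin[OF xc])
    then have "proj_pt (x t) \<in> A \<or> proj_pt (x t) \<in> B" using AB by blast
    then show False
      using t(1,2) f(1) g(1) mem_proj_pt_self[of "x t"] by (auto simp: S T zero_locus_def)
  qed
qed

section \<open>Dimension bounds from chains\<close>

text \<open>Used both to climb through linear subspaces and to pass from a center to the whole
  critical locus.\<close>

lemma irreducible_chain_extend:
  assumes "irreducible_chain k Z C d" "C d = Z" "Z \<subset> X" "zariski_closed k X" "zariski_irreducible k X"
  shows "\<exists>C'. irreducible_chain k X C' (Suc d) \<and> C' (Suc d) = X"
proof -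
  let ?C = "\<lambda>i. if i \<le> d then C i else X"
  have "irreducible_chain k X ?C (Suc d)"
    using assms unfolding irreducible_chain_def by (auto simp: le_Suc_eq less_Suc_eq)
  then show ?thesis by (intro exI[of _ ?C]) simp
qed

text \<open>Adding a coordinate form that is nonzero somewhere on the locus cuts out a smaller
  linear locus, whose chain is then extended by the locus itself. The forms may be dependent, as
  only a lower bound for the dimension is sought.\<close>

lemma linear_locus_chain:
  assumes "length as \<le> k"
  shows "\<exists>C. irreducible_chain k (zero_locus k (lin_form k ` set as)) C (k - length as)
      \<and> C (k - length as) = zero_locus k (lin_form k ` set as)"
  using assms
proof (induction "k - length as" arbitrary: as)
  case 0
  let ?L = "zero_locus k (lin_form k ` set as)"
  have "zariski_closed k ?L"
    by (rule zariski_closed_zero_locus_homog) (auto intro: homog_poly_lin_form)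
  then show ?case
    using irreducible_linear_locus[OF 0(2)] 0
    by (intro exI[of _ "\<lambda>_. ?L"]) (auto simp: irreducible_chain_def)
next
  case (Suc d)
  let ?L = "zero_locus k (lin_form k ` set as)"
  obtain v where v: "v \<in> carrier_vec (k + 1)" "v \<noteq> 0\<^sub>v (k + 1)"
    "\<forall>a \<in> set as. poly_eval (lin_form k a) v = 0"
    using exists_common_zero[OF Suc(3)] by blast
  obtain j where j: "j < k + 1" "v $ j \<noteq> 0"
    using v(1,2) by (metis carrier_vecD eq_vecI index_zero_vec(1,2))
  \<comment> \<open>The added form is the coordinate \<open>j\<close>, which is nonzero at
    \<open>v\<close>.\<close>
  let ?bs = "(\<lambda>l. if l = j then 1 else 0) # as"
  let ?L' = "zero_locus k (lin_form k ` set ?bs)"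
  have "poly_eval (lin_form k (\<lambda>l. if l = j then 1 else 0)) v \<noteq> 0"
    using j by (simp add: poly_eval_lin_form if_distrib[of "\<lambda>x. x * _"] cong: if_cong)
  then have "proj_pt v \<in> ?L" "proj_pt v \<notin> ?L'"
    using v(3) by (auto simp: proj_pt_zero_locus_lin[OF v(1,2)] simp del: set_simps intro: list.set_intros)
  moreover have "?L' \<subseteq> ?L" by (auto simp: zero_locus_def)
  ultimately have sub: "?L' \<subset> ?L" by blast
  have len: "d = k - length ?bs" "length ?bs \<le> k" using Suc(2) by auto
  obtain C where "irreducible_chain k ?L' C d" "C d = ?L'"
    using Suc(1)[OF len] len(1) by auto
  then have "\<exists>C'. irreducible_chain k ?L C' (Suc d) \<and> C' (Suc d) = ?L"
    by (rule irreducible_chain_extend[OF _ _ sub])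
       (auto intro!: zariski_closed_zero_locus_homog homog_poly_lin_form irreducible_linear_locus[OF Suc(3)])
  then show ?case using Suc(2) by simp
qed

section \<open>The critical locus\<close>

lemma zero_locus_poly_ideal: "zero_locus k (poly_ideal k S) = zero_locus k S"
proof -
  have one: "1 \<in> poly_ring k" by (simp add: poly_ring_def)
  have "S \<subseteq> poly_ideal k S"
  proof
    fix s assume "s \<in> S"
    then show "s \<in> poly_ideal k S"
      unfolding poly_ideal_def using one
      by (intro CollectI exI[of _ "{s}"] exI[of _ "\<lambda>_. 1"]) simp
  qed
  moreover have "poly_eval f v = 0" if "f \<in> poly_ideal k S" "\<forall>s \<in> S. poly_eval s v = 0" for f v
    using that by (auto simp: poly_ideal_def poly_eval_sum poly_eval_mult subset_iff intro!: sum.neutral)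
  ultimately show ?thesis unfolding zero_locus_def by blast
qed

lemma poly_ideal_subset_vanish2: "S \<subseteq> vanish2 v \<Longrightarrow> poly_ideal k S \<subseteq> vanish2 v"
  unfolding poly_ideal_def by (auto intro!: vanish2_sum vanish2_mult)

lemma local_dim_le_krull_dim: "local_dim k Z p \<le> krull_dim k Z"
  unfolding local_dim_def krull_dim_def by (rule Sup_subset_mono) blast

lemma subspace_dim_carrier: "subspace_dim N (carrier_vec N) = N"
  using vec_space.dim_is_n[where 'a = complex, of N]
  by (simp add: subspace_dim_def module_vec_def)

text \<open>All linearized equations are trivial, so the tangent space is everything.\<close>

lemma cone_tangent_space_vanish2:
  assumes "I \<subseteq> vanish2 v"
  shows "cone_tangent_space k I v = carrier_vec (k + 1)"
  using assms by (auto simp: cone_tangent_space_def vanish2_def intro!: sum.neutral)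

section \<open>The maximal minors\<close>

definition critical_minors ::
    "nat \<Rightarrow> nat \<Rightarrow> (nat \<Rightarrow> nat) \<Rightarrow> (nat \<Rightarrow> complex mat) \<Rightarrow> (nat \<Rightarrow> complex mat) \<Rightarrow> cpoly set" where
  "critical_minors n k h P Q = {det (submatrix (critical_matrix n k h P Q) R UNIV) | R.
     R \<subseteq> {..<dim_row (critical_matrix n k h P Q)} \<and> card R = n + k + 1}"

lemma critical_ideal_minors: "critical_ideal n k h P Q = poly_ideal k (critical_minors n k h P Q)"
  by (simp add: critical_ideal_def critical_minors_def)

text \<open>Confines the bookkeeping with \<open>submatrix\<close> and \<open>pick\<close> to one
  place: afterwards a minor is handled only through the block form of its rows.\<close>

lemma critical_minorE:
  assumes "f \<in> critical_minors n k h P Q"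
  obtains A where "A \<in> carrier_mat (n + k + 1) (n + k + 1)" "f = det A"
    "\<And>r. r < n + k + 1 \<Longrightarrow> \<exists>i a. i < n \<and> a \<le> h i \<and>
       (\<forall>c < n + k + 1. A $$ (r, c) = critical_row n k P Q i a $ c)"
proof -
  let ?M = "critical_matrix n k h P Q"
  let ?rows = "concat (map (\<lambda>i. map (critical_row n k P Q i) [0..<h i + 1]) [0..<n])"
  obtain R where R: "R \<subseteq> {..<dim_row ?M}" "card R = n + k + 1" and f: "f = det (submatrix ?M R UNIV)"
    using assms by (auto simp: critical_minors_def)
  have dim_row: "dim_row ?M = length ?rows" and dim_col: "dim_col ?M = n + k + 1"
    by (simp_all add: critical_matrix_def)
  have cardR: "card {i. i < dim_row ?M \<and> i \<in> R} = n + k + 1"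
  proof -
    have "{i. i < dim_row ?M \<and> i \<in> R} = R" using R(1) by auto
    then show ?thesis using R(2) by simp
  qed
  have carrier: "submatrix ?M R UNIV \<in> carrier_mat (n + k + 1) (n + k + 1)"
    by (rule carrier_matI) (simp_all add: dim_submatrix cardR dim_col)
  have "\<exists>i a. i < n \<and> a \<le> h i \<and>
       (\<forall>c < n + k + 1. submatrix ?M R UNIV $$ (r, c) = critical_row n k P Q i a $ c)"
    if r: "r < n + k + 1" for r
  proof -
    have pick: "pick R r < dim_row ?M" using r cardR by (intro pick_le) simp
    then have "?rows ! pick R r \<in> set ?rows" unfolding dim_row by (rule nth_mem)
    then obtain i a where ia: "i < n" "a \<le> h i" "?rows ! pick R r = critical_row n k P Q i a"
      by (auto simp del: upt_Suc simp: less_Suc_eq_le)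
    have "submatrix ?M R UNIV $$ (r, c) = critical_row n k P Q i a $ c" if c: "c < n + k + 1" for c
    proof -
      have "submatrix ?M R UNIV $$ (r, c) = ?M $$ (pick R r, c)"
        using r c by (subst submatrix_index) (auto simp: cardR dim_col pick_UNIV)
      also have "\<dots> = ?rows ! pick R r $ c"
        using pick c unfolding dim_row critical_matrix_def by (simp add: mat_of_rows_def del: upt_Suc)
      finally show ?thesis by (simp only: ia(3))
    qed
    then show ?thesis using ia by blast
  qed
  then show thesis using that carrier f by blast
qed

lemma critical_row_lin_form:
  "critical_row n k P Q i a = vec (n + k + 1) (\<lambda>j.
     if j \<le> k then poly_const (P i $$ (a, j))
     else if j = k + 1 + i then lin_form k (\<lambda>l. Q i $$ (a, l)) else 0)"
  unfolding critical_row_def lin_form_def ..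

text \<open>The first \<open>k + 1\<close> columns are constant and the other \<open>n\<close> are
  linear, so the degree is \<open>n\<close>.\<close>

lemma homog_poly_critical_minors:
  assumes "f \<in> critical_minors n k h P Q"
  shows "homog_poly k (\<Sum>c<n + k + 1. if c \<le> k then 0 else 1) f"
  using assms
proof (cases rule: critical_minorE)
  case (1 A)
  show ?thesis unfolding 1(2)
  proof (rule homog_poly_det[OF 1(1)])
    fix r c assume "r < n + k + 1" "c < n + k + 1"
    then show "homog_poly k (if c \<le> k then 0 else 1) (A $$ (r, c))"
      using 1(3)[of r] homog_poly_lin_form
      by (auto simp: critical_row_lin_form homog_poly_const homog_poly_0)
  qed
qed

text \<open>The ideal also contains inhomogeneous multiples, so the locus is rewritten as that of
  the minors.\<close>

lemma zariski_closed_critical_locus: "zariski_closed k (critical_locus n k h P Q)"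
  unfolding critical_ideal_minors zero_locus_poly_ideal
  using homog_poly_critical_minors by (rule zariski_closed_zero_locus_homog)

section \<open>Minors at points of the centers\<close>

text \<open>If \<open>r\<close> is the number of rows of \<open>A\<close>, the common zeros of these
  forms give its center. A list shows the number of equations as its length.\<close>

definition row_forms :: "complex mat \<Rightarrow> nat \<Rightarrow> (nat \<Rightarrow> complex) list" where
  "row_forms A r = map (\<lambda>a l. A $$ (a, l)) [0..<r]"

lemma length_row_forms [simp]: "length (row_forms A r) = r"
  by (simp add: row_forms_def)

text \<open>In the column of view \<open>i\<close>, rows of other blocks are zero and rows of block
  \<open>i\<close> are the forms of \<open>Q i\<close>.\<close>

lemma critical_column_vanish:
  assumes "i < n" "\<forall>b \<in> set (row_forms (Q i) (h i + 1)). poly_eval (lin_form k b) v = 0"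
    and "j < n" "a \<le> h j"
  shows "critical_row n k P Q j a $ (k + 1 + i) \<in> vanish1 v"
  using assms by (auto simp: critical_row_lin_form vanish1_def row_forms_def simp del: upt_Suc)

lemma critical_minors_vanish1:
  assumes "i < n" "\<forall>b \<in> set (row_forms (Q i) (h i + 1)). poly_eval (lin_form k b) v = 0"
  shows "critical_minors n k h P Q \<subseteq> vanish1 v"
proof
  fix f assume "f \<in> critical_minors n k h P Q"
  then show "f \<in> vanish1 v"
  proof (cases rule: critical_minorE)
    case (1 A)
    have "A $$ (r, k + 1 + i) \<in> vanish1 v" if r: "r < n + k + 1" for r
    proof -
      obtain j a where "j < n" "a \<le> h j" "A $$ (r, k + 1 + i) = critical_row n k P Q j a $ (k + 1 + i)"
        using 1(3)[OF r] assms(1) by auto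
      then show ?thesis using critical_column_vanish[of i n Q h, OF assms] by simp
    qed
    then show ?thesis
      unfolding 1(2) using assms(1) by (intro det_in_vanish1[OF 1(1), of "k + 1 + i"]) auto
  qed
qed

lemma critical_minors_vanish2:
  assumes i: "i < n" "\<forall>b \<in> set (row_forms (Q i) (h i + 1)). poly_eval (lin_form k b) v = 0"
    and j: "j < n" "\<forall>b \<in> set (row_forms (Q j) (h j + 1)). poly_eval (lin_form k b) v = 0"
    and "i \<noteq> j"
  shows "critical_minors n k h P Q \<subseteq> vanish2 v"
proof
  fix f assume "f \<in> critical_minors n k h P Q"
  then show "f \<in> vanish2 v"
  proof (cases rule: critical_minorE)
    case (1 A)
    have "A $$ (r, k + 1 + i) \<in> vanish1 v \<and> A $$ (r, k + 1 + j) \<in> vanish1 v" if r: "r < n + k + 1" for r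
    proof -
      obtain l a where "l < n" "a \<le> h l"
        "A $$ (r, k + 1 + i) = critical_row n k P Q l a $ (k + 1 + i)"
        "A $$ (r, k + 1 + j) = critical_row n k P Q l a $ (k + 1 + j)"
        using 1(3)[OF r] i(1) j(1) by auto
      then show ?thesis
        using critical_column_vanish[of i n Q h, OF i] critical_column_vanish[of j n Q h, OF j] by simp
    qed
    then show ?thesis
      unfolding 1(2) using i(1) j(1) \<open>i \<noteq> j\<close>
      by (intro det_in_vanish2[OF 1(1), of "k + 1 + i" "k + 1 + j"]) auto
  qed
qed

theorem theorem4p1:
  fixes n k :: nat and h :: "nat \<Rightarrow> nat" and P Q :: "nat \<Rightarrow> complex mat"
  assumes "n \<ge> 4"
    and "\<And>i. i < n \<Longrightarrow> is_projection k (h i) (P i)"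
    and "\<And>i. i < n \<Longrightarrow> is_projection k (h i) (Q i)"
    and "(\<Inter>i<n. center k (P i)) = {}"
    and "(\<Inter>i<n. center k (Q i)) = {}"
    and "krull_dim k (critical_locus n k h P Q) = ereal (2 * real k - (\<Sum>i<n. real (h i)))"
    and "(\<Sum>i<n. int (h i)) - int k \<ge> 2"
  shows "\<not> zariski_irreducible k (critical_locus n k h P Q) \<or>
         \<not> smooth_subscheme k (critical_ideal n k h P Q)"
proof (rule ccontr)
  let ?X = "critical_locus n k h P Q"
  let ?I = "critical_ideal n k h P Q"
  let ?F = "\<lambda>i. row_forms (Q i) (h i + 1)"
  let ?L = "\<lambda>i. zero_locus k (lin_form k ` set (?F i))"
  assume "\<not> ?thesis"
  then have irr: "zariski_irreducible k ?X" and smooth: "smooth_subscheme k ?I" by auto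
  have h: "h i < k" if "i < n" for i
    using assms(3)[OF that] by (simp add: is_projection_def)
  have sum_h: "real k + 2 \<le> (\<Sum>i<n. real (h i))"
  proof -
    have "real_of_int ((\<Sum>i<n. int (h i)) - int k) \<ge> 2" using assms(7) by linarith
    then show ?thesis by simp
  qed
  have center_sub: "?L i \<subseteq> ?X" if i: "i < n" for i
    unfolding critical_ideal_minors zero_locus_poly_ideal
  proof
    fix p assume p: "p \<in> ?L i"
    have "critical_minors n k h P Q \<subseteq> vanish1 v" if "v \<in> p" for v
      using p that by (intro critical_minors_vanish1[OF i]) (auto simp: zero_locus_def)
    then show "p \<in> zero_locus k (critical_minors n k h P Q)"
      using p by (auto simp: zero_locus_def vanish1_def)
  qed
  have no_common_zero: False
    if ij: "i < n" "j < n" "i \<noteq> j" and p: "p \<in> ?L i" "p \<in> ?L j" for i j p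
  proof -
    have pX: "p \<in> ?X" using center_sub[OF ij(1)] p by blast
    then obtain v where v: "v \<in> p" by (auto simp: zero_locus_def proj_space_def intro: mem_proj_pt_self)
    have "critical_minors n k h P Q \<subseteq> vanish2 v"
      using p v by (intro critical_minors_vanish2[OF ij(1) _ ij(2) _ ij(3)]) (auto simp: zero_locus_def)
    then have "?I \<subseteq> vanish2 v" unfolding critical_ideal_minors by (rule poly_ideal_subset_vanish2)
    \<comment> \<open>Smoothness turns the full tangent space into local dimension \<open>k\<close>,
      while the whole locus has dimension at most \<open>k - 2\<close>.\<close>
    then have "ereal (real (k + 1)) = local_dim k ?X p + 1"
      using smooth pX v unfolding smooth_subscheme_def
      by (metis cone_tangent_space_vanish2 subspace_dim_carrier)
    also have "\<dots> \<le> ereal (2 * real k - (\<Sum>i<n. real (h i))) + 1"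
      using local_dim_le_krull_dim[of k ?X p] unfolding assms(6) by (rule add_right_mono)
    finally have "real (k + 1) \<le> 2 * real k - (\<Sum>i<n. real (h i)) + 1"
      by (simp add: one_ereal_def)
    then show False using sum_h by simp
  qed
  have pair: "h i + h j + 1 \<ge> k" if ij: "i < n" "j < n" "i \<noteq> j" for i j
  proof (rule ccontr)
    assume "\<not> ?thesis"
    \<comment> \<open>The two centers together are cut out by \<open>h i + h j + 2\<close>
      forms.\<close>
    then have "length (?F i @ ?F j) \<le> k" by simp
    then obtain v where v: "v \<in> carrier_vec (k + 1)" "v \<noteq> 0\<^sub>v (k + 1)"
      "\<forall>a \<in> set (?F i @ ?F j). poly_eval (lin_form k a) v = 0"
      using exists_common_zero by blast
    then have "proj_pt v \<in> ?L i" "proj_pt v \<in> ?L j"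
      by (auto simp: proj_pt_zero_locus_lin[OF v(1,2)])
    then show False using no_common_zero[OF ij] by blast
  qed
  have codim_le: "(\<Sum>l<n. real (h l)) \<le> real k + real (h i)" if i: "i < n" for i
  proof -
    have len: "length (?F i) \<le> k" using h[OF i] by simp
    \<comment> \<open>Any other view serves: its center supplies a point of the locus outside
      \<open>?L i\<close>, which makes the inclusion strict.\<close>
    define j where "j = (if i = 0 then 1 else 0 :: nat)"
    have j: "j < n" "j \<noteq> i" using \<open>n \<ge> 4\<close> by (auto simp: j_def)
    have "zariski_irreducible k (?L j)" using h[OF j(1)] by (intro irreducible_linear_locus) simp
    then obtain p where p: "p \<in> ?L j" by (auto simp: zariski_irreducible_def)
    then have "p \<in> ?X" "p \<notin> ?L i" using center_sub[OF j(1)] no_common_zero[OF i j(1) j(2)[symmetric]] by auto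
    then have "?L i \<subset> ?X" using center_sub[OF i] by blast
    moreover obtain C where "irreducible_chain k (?L i) C (k - (h i + 1))" "C (k - (h i + 1)) = ?L i"
      using linear_locus_chain[OF len] by auto
    \<comment> \<open>Putting the critical locus on top of the chain in the center gains one step,
      giving dimension at least \<open>k - h i\<close>.\<close>
    ultimately obtain C' where "irreducible_chain k ?X C' (Suc (k - (h i + 1)))"
      using irreducible_chain_extend[OF _ _ _ zariski_closed_critical_locus irr] by blast
    then have "ereal (real (Suc (k - (h i + 1)))) \<le> krull_dim k ?X"
      unfolding krull_dim_def by (intro Sup_upper) blast
    then have "real (Suc (k - (h i + 1))) \<le> 2 * real k - (\<Sum>l<n. real (h l))"
      unfolding assms(6) by simp
    moreover have "Suc (k - (h i + 1)) = k - h i" using h[OF i] by simp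
    ultimately show ?thesis using h[OF i] by (simp add: of_nat_diff)
  qed
  have four: "(\<Sum>l<n. real (h l)) \<ge> real (h 0) + real (h 1) + real (h 2) + real (h 3)"
  proof -
    have "(\<Sum>l<4. real (h l)) \<le> (\<Sum>l<n. real (h l))"
      using \<open>n \<ge> 4\<close> by (intro sum_mono2) auto
    then show ?thesis by (simp add: eval_nat_numeral)
  qed
  have lt: "0 < n" "1 < n" "2 < n" "3 < n" using \<open>n \<ge> 4\<close> by auto
  \<comment> \<open>\<open>codim_le\<close> for view 3 bounds the sum over views 0, 1, 2 by
    \<open>k\<close>. Disjointness of the centers of views 0 and 1 and \<open>codim_le\<close> for
    view 2 make this sum at least \<open>k + 1\<close>.\<close>
  have "real (h 0) + real (h 1) + 1 \<ge> real k" using pair[OF lt(1,2)] by simp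
  moreover have "real (h 2) \<ge> 2" using codim_le[OF lt(3)] sum_h by simp
  moreover have "real (h 0) + real (h 1) + real (h 2) \<le> real k" using codim_le[OF lt(4)] four by simp
  ultimately show False by simp
qed

end
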